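(* Let $m\ge 1$ and let $\underline{r}=(r_1,r_2,\ldots,r_m)$ be a tuple of pairwise relatively prime integers greater than $1$ such that $r_2,r_3,\ldots,r_m\equiv 1 \pmod{r_1}$. Then for every integer $j$ with $1\leq j\leq r_1-1$ and every positive integer $n$, \[ X_{\underline{r},j,n}-Y_{\underline{r},j,n}=c_{\underline{r},n}. \]
   Context: A partition is a finite weakly decreasing sequence $\lambda=(\lambda_1,\ldots,\lambda_\ell)$ of positive integers; $|\lambda|=\sum_i\lambda_i$ is its size and $m_i(\lambda)$ the multiplicity of $i$ as a part of $\lambda$. The suffix $(n)$ on a set of partitions means restriction to partitions of size $n$. For an integer $r\ge2$: $\mathcal{RP}_r$ is the set of partitions with $m_k(\lambda)<r$ for all $k\ge1$; $\mathcal{CP}_r$ is the set of partitions with $m_{rk}(\lambda)=0$ for all $k\geq1$. For a tuple $\underline{r}=(r_1,\ldots,r_m)$ of pairwise relatively prime integers greater than $1$, define \[ \mathcal{CP}_{\underline{r}}=\{\lambda : m_{r_ik}(\lambda)=0 \text{ for all } 1\le i\le m \text{ and all } k\geq 1\}, \] put $\underline{s}=(r_2,\ldots,r_m)$, define $\mathcal{CP}_{\underline{s}}$ in the same way (it is the set of all partitions if $m=1$), and let $\mathcal{RP}_{\underline{r}}=\mathcal{RP}_{r_1}\cap\mathcal{CP}_{\underline{s}}$. For $1\le j\le r_1-1$ and partitions $\lambda,\mu$, let \[ x_{r_1,j}(\lambda)=\#\{i : \lambda_i\equiv j \pmod{r_1}\},\qquad y_{r_1,j}(\mu)=\#\{k\geq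 1 : m_k(\mu)\geq j\}, \] and \[ X_{\underline{r},j,n}=\sum_{\lambda\in\mathcal{CP}_{\underline{r}}(n)}x_{r_1,j}(\lambda),\qquad Y_{\underline{r},j,n}=\sum_{\mu\in\mathcal{RP}_{\underline{r}}(n)}y_{r_1,j}(\mu). \] Glaisher operations: for an integer $r\geq 2$, starting from $\lambda\in\mathcal{CP}_r$, as long as some $k$ occurs at least $r$ times as a part, perform the operation of replacing $r$ copies of the part $k$ by a single part $rk$; repeat until the partition lies in $\mathcal{RP}_r$. The number of operations performed is denoted $c_r(\lambda)$; it does not depend on the choices made. Since $\mathcal{CP}_{\underline{r}}\subseteq\mathcal{CP}_{r_1}$, one may define \[ c_{\underline{r},n}=\sum_{\lambda\in\mathcal{CP}_{\underline{r}}(n)}c_{r_1}(\lambda). \] *)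

theory Defs
  imports "HOL-Library.Multiset" "HOL-Number_Theory.Cong"
begin

text \<open>A partition is represented by the multiset of its parts, so that
  \<open>count \<rho> k\<close> is the multiplicity $m_k(\rho)$ and \<open>\<Sum>\<^sub># \<rho>\<close> is the size $|\rho|$.
  The lemma \<open>partitions_as_lists\<close> below relates this to weakly decreasing sequences.\<close>

definition partitions :: "nat multiset set" where
  "partitions = {\<rho>. \<forall>k \<in># \<rho>. k \<ge> 1}"

definition of_size :: "nat multiset set \<Rightarrow> nat \<Rightarrow> nat multiset set" where
  "of_size P n = {\<rho> \<in> P. \<Sum>\<^sub># \<rho> = n}"

definition RP :: "nat \<Rightarrow> nat multiset set" where
  "RP r = {\<rho> \<in> partitions. \<forall>k\<ge>1. count \<rho> k < r}"

definition CP :: "nat \<Rightarrow> nat multiset set" where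
  "CP r = {\<rho> \<in> partitions. \<forall>k\<ge>1. count \<rho> (r * k) = 0}"

text \<open>A tuple $(r_1,\ldots,r_m)$ is a nonempty list \<open>rs\<close>, with $r_1$ being \<open>hd rs\<close> and
  $(r_2,\ldots,r_m)$ being \<open>tl rs\<close>.\<close>

definition CP_tuple :: "nat list \<Rightarrow> nat multiset set" where
  "CP_tuple rs = {\<rho> \<in> partitions. \<forall>i<length rs. \<forall>k\<ge>1. count \<rho> (rs ! i * k) = 0}"

definition RP_tuple :: "nat list \<Rightarrow> nat multiset set" where
  "RP_tuple rs = RP (hd rs) \<inter> CP_tuple (tl rs)"

definition x_stat :: "nat \<Rightarrow> nat \<Rightarrow> nat multiset \<Rightarrow> nat" where
  "x_stat r j \<rho> = size {#p \<in># \<rho>. [p = j] (mod r)#}"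

definition y_stat :: "nat \<Rightarrow> nat multiset \<Rightarrow> nat" where
  "y_stat j \<mu> = card {k. k \<ge> 1 \<and> count \<mu> k \<ge> j}"

definition X_sum :: "nat list \<Rightarrow> nat \<Rightarrow> nat \<Rightarrow> nat" where
  "X_sum rs j n = (\<Sum>\<rho> \<in> of_size (CP_tuple rs) n. x_stat (hd rs) j \<rho>)"

definition Y_sum :: "nat list \<Rightarrow> nat \<Rightarrow> nat \<Rightarrow> nat" where
  "Y_sum rs j n = (\<Sum>\<mu> \<in> of_size (RP_tuple rs) n. y_stat j \<mu>)"

inductive glaisher_step :: "nat \<Rightarrow> nat multiset \<Rightarrow> nat multiset \<Rightarrow> bool" for r where
  "count \<rho> k \<ge> r \<Longrightarrow> glaisher_step r \<rho> (\<rho> - replicate_mset r k + {#r * k#})"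

text \<open>The number of operations in a run from \<open>\<rho>\<close> to \<open>RP r\<close>; the lemmas
  \<open>glaisher_run_exists\<close> and \<open>glaisher_run_unique\<close> below show that it is well defined.\<close>

definition glaisher_count :: "nat \<Rightarrow> nat multiset \<Rightarrow> nat" where
  "glaisher_count r \<rho> = (THE t. \<exists>\<mu> \<in> RP r. (glaisher_step r ^^ t) \<rho> \<mu>)"

definition c_sum :: "nat list \<Rightarrow> nat \<Rightarrow> nat" where
  "c_sum rs n = (\<Sum>\<rho> \<in> of_size (CP_tuple rs) n. glaisher_count (hd rs) \<rho>)"

lemma partitions_as_lists:
  "bij_betw mset {xs :: nat list. sorted_wrt (\<ge>) xs \<and> (\<forall>x \<in> set xs. x \<ge> 1)} partitions"
proof (rule bij_betwI')
  fix xs ys :: "nat list"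
  assume "xs \<in> {xs. sorted_wrt (\<ge>) xs \<and> (\<forall>x \<in> set xs. x \<ge> 1)}"
    and "ys \<in> {xs. sorted_wrt (\<ge>) xs \<and> (\<forall>x \<in> set xs. x \<ge> 1)}"
  then have s: "sorted (rev xs)" "sorted (rev ys)"
    by (simp_all add: sorted_wrt_rev)
  show "mset xs = mset ys \<longleftrightarrow> xs = ys"
  proof
    assume "mset xs = mset ys"
    then have "mset (rev xs) = mset (rev ys)" by simp
    then have "rev xs = rev ys" using s by (metis properties_for_sort)
    then show "xs = ys" by simp
  qed simp
next
  fix xs :: "nat list"
  assume "xs \<in> {xs. sorted_wrt (\<ge>) xs \<and> (\<forall>x \<in> set xs. x \<ge> 1)}"
  then show "mset xs \<in> partitions" by (simp add: partitions_def)
next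
  fix M assume M: "M \<in> partitions"
  show "\<exists>xs \<in> {xs. sorted_wrt (\<ge>) xs \<and> (\<forall>x \<in> set xs. x \<ge> 1)}. M = mset xs"
    using M
    by (intro bexI[of _ "rev (sorted_list_of_multiset M)"])
      (auto simp: partitions_def sorted_wrt_rev)
qed

lemma finite_of_size_partitions: "finite (of_size partitions n)"
proof (rule finite_subset)
  show "of_size partitions n \<subseteq> mset ` {xs. set xs \<subseteq> {..n} \<and> length xs \<le> n}"
  proof
    fix M assume M: "M \<in> of_size partitions n"
    obtain xs where xs: "M = mset xs" by (metis ex_mset)
    from M have pos: "\<forall>x \<in> set xs. x \<ge> 1" and n: "sum_list xs = n"
      by (simp_all add: of_size_def partitions_def xs sum_mset_sum_list)
    have "length xs \<le> sum_list xs" using pos by (induction xs) auto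
    moreover have "set xs \<subseteq> {..n}" using n member_le_sum_list by auto
    ultimately show "M \<in> mset ` {xs. set xs \<subseteq> {..n} \<and> length xs \<le> n}"
      using xs n by auto
  qed
  show "finite (mset ` {xs. set xs \<subseteq> {..n} \<and> length xs \<le> n})"
    by (intro finite_imageI finite_lists_length_le) simp
qed

lemma glaisher_step_partitions:
  assumes "r \<ge> 2" and "\<rho> \<in> partitions" and "glaisher_step r \<rho> \<mu>"
  shows "\<mu> \<in> partitions \<and> size \<mu> < size \<rho>"
proof -
  from assms(3) obtain k where k: "count \<rho> k \<ge> r"
    and \<mu>: "\<mu> = \<rho> - replicate_mset r k + {#r * k#}"
    by cases
  have sub: "replicate_mset r k \<subseteq># \<rho>" using k by (simp add: count_le_replicate_mset_subset_eq)
  have "k \<in># \<rho>" using k assms(1) by (metis count_eq_zero_iff not_numeral_le_zero le_trans)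
  then have "r * k \<ge> 1" using assms(1,2) by (auto simp: partitions_def)
  then have "\<mu> \<in> partitions" using assms(2) by (auto simp: \<mu> partitions_def dest: in_diffD)
  moreover have "size \<mu> < size \<rho>"
    using sub size_mset_mono[OF sub] assms(1) by (simp add: \<mu> size_Diff_submset)
  ultimately show ?thesis ..
qed

lemma glaisher_run_exists:
  assumes "r \<ge> 2" and "\<rho> \<in> partitions"
  shows "\<exists>t. \<exists>\<mu> \<in> RP r. (glaisher_step r ^^ t) \<rho> \<mu>"
  using assms(2)
proof (induction "size \<rho>" arbitrary: \<rho> rule: less_induct)
  case less
  show ?case
  proof (cases "\<rho> \<in> RP r")
    case True
    then show ?thesis by (metis relpowp_0_I)
  next
    case False
    then obtain k where "count \<rho> k \<ge> r" using less.prems by (auto simp: RP_def not_less)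
    then obtain \<nu> where s: "glaisher_step r \<rho> \<nu>" by (meson glaisher_step.intros)
    then have "\<nu> \<in> partitions" "size \<nu> < size \<rho>"
      using glaisher_step_partitions[OF assms(1) less.prems] by auto
    from less.hyps[OF this(2,1)] show ?thesis using s by (meson relpowp_Suc_I2)
  qed
qed

lemma glaisher_step_diamond:
  assumes "glaisher_step r \<rho> \<alpha>" and "glaisher_step r \<rho> \<beta>" and "\<alpha> \<noteq> \<beta>"
  shows "\<exists>\<gamma>. glaisher_step r \<alpha> \<gamma> \<and> glaisher_step r \<beta> \<gamma>"
proof -
  from assms(1) obtain k where k: "count \<rho> k \<ge> r"
    and \<alpha>: "\<alpha> = \<rho> - replicate_mset r k + {#r * k#}"
    by cases
  from assms(2) obtain l where l: "count \<rho> l \<ge> r"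
    and \<beta>: "\<beta> = \<rho> - replicate_mset r l + {#r * l#}"
    by cases
  have ne: "k \<noteq> l" using assms(3) \<alpha> \<beta> by auto
  have "glaisher_step r \<alpha> (\<alpha> - replicate_mset r l + {#r * l#})"
    using l ne by (intro glaisher_step.intros) (simp add: \<alpha>)
  moreover have "glaisher_step r \<beta> (\<beta> - replicate_mset r k + {#r * k#})"
    using k ne by (intro glaisher_step.intros) (simp add: \<beta>)
  moreover have "\<alpha> - replicate_mset r l + {#r * l#} = \<beta> - replicate_mset r k + {#r * k#}"
    using k l ne by (intro multiset_eqI) (auto simp: \<alpha> \<beta>)
  ultimately show ?thesis by metis
qed

lemma RP_no_glaisher_step:
  assumes "r \<ge> 2" and "\<rho> \<in> RP r"
  shows "\<not> glaisher_step r \<rho> \<mu>"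
proof
  assume "glaisher_step r \<rho> \<mu>"
  then obtain k where k: "count \<rho> k \<ge> r" by cases
  have "k \<in># \<rho>" using k assms(1) by (metis count_eq_zero_iff not_numeral_le_zero le_trans)
  then show False using k assms(2) by (fastforce simp: RP_def partitions_def)
qed

lemma glaisher_run_step:
  assumes "r \<ge> 2" and "\<mu> \<in> RP r"
    and "(glaisher_step r ^^ t) \<rho> \<mu>" and "glaisher_step r \<rho> \<alpha>"
  shows "\<exists>u. t = Suc u \<and> (glaisher_step r ^^ u) \<alpha> \<mu>"
  using assms(3,4)
proof (induction t arbitrary: \<rho> \<alpha>)
  case 0
  then show ?case using RP_no_glaisher_step[OF assms(1,2)] by auto
next
  case (Suc t)
  from Suc.prems(1) obtain \<beta> where b: "glaisher_step r \<rho> \<beta>" "(glaisher_step r ^^ t) \<beta> \<mu>"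
    by (meson relpowp_Suc_D2)
  show ?case
  proof (cases "\<alpha> = \<beta>")
    case True
    then show ?thesis using b by blast
  next
    case False
    then obtain \<gamma> where g: "glaisher_step r \<alpha> \<gamma>" "glaisher_step r \<beta> \<gamma>"
      using glaisher_step_diamond[OF Suc.prems(2) b(1)] by auto
    from Suc.IH[OF b(2) g(2)] obtain u where "t = Suc u" "(glaisher_step r ^^ u) \<gamma> \<mu>" by auto
    then show ?thesis using g(1) by (metis relpowp_Suc_I2)
  qed
qed

lemma glaisher_run_unique:
  assumes "r \<ge> 2" and "\<mu> \<in> RP r" and "\<nu> \<in> RP r"
    and "(glaisher_step r ^^ t) \<rho> \<mu>" and "(glaisher_step r ^^ u) \<rho> \<nu>"
  shows "t = u \<and> \<mu> = \<nu>"
  using assms(4,5)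
proof (induction u arbitrary: t \<rho>)
  case 0
  then have e: "\<rho> = \<nu>" by simp
  show ?case
  proof (cases t)
    case 0
    then show ?thesis using e "0.prems" by simp
  next
    case (Suc v)
    then show ?thesis
      using "0.prems"(1) e RP_no_glaisher_step[OF assms(1,3)] by (meson relpowp_Suc_D2)
  qed
next
  case (Suc u)
  from Suc.prems(2) obtain \<beta> where b: "glaisher_step r \<rho> \<beta>" "(glaisher_step r ^^ u) \<beta> \<nu>"
    by (meson relpowp_Suc_D2)
  from glaisher_run_step[OF assms(1,2) Suc.prems(1) b(1)]
  obtain v where "t = Suc v" "(glaisher_step r ^^ v) \<beta> \<mu>" by auto
  then show ?case using Suc.IH b(2) by auto
qed

end

theory Submission
  imports Defs
begin

text \<open>
  Write \<open>r\<close> for the first modulus, let \<open>A\<close> be the set of positive integers divisible by none of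
  the other moduli, and let \<open>p N\<close> be the number of partitions of \<open>N\<close> with parts in \<open>A\<close> not
  divisible by \<open>r\<close>. Coprimality makes \<open>A\<close> stable under multiplication and division by \<open>r\<close>, so
  Glaisher's bijection identifies these partitions with those having parts in \<open>A\<close> of
  multiplicity less than \<open>r\<close> (\<open>bij_flatten\<close>); hence \<open>p\<close> counts both kinds.

  Put \<open>U J = \<Sum> p (n - k * l)\<close>, summed over \<open>k\<close> in \<open>A\<close> and \<open>l \<ge> 1\<close> with \<open>l\<close> congruent to \<open>J\<close>
  modulo \<open>r\<close>. The proof expresses both statistics in terms of \<open>U\<close>.

  \<^item> Counting an occurrence of a part \<open>k\<close> together with its rank \<open>l\<close> among the copies of \<open>k\<close>, and
    removing \<open>l\<close> copies, the sum of the \<open>x\<close> statistic becomes the sum of \<open>p (n - k * l)\<close> with the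
    congruence imposed on \<open>k\<close> instead of \<open>l\<close> (\<open>sum_x_stat\<close>). Moving the congruence from \<open>k\<close> to
    \<open>l\<close> changes nothing (\<open>divisor_count_swap\<close>). This is where the other moduli must be congruent
    to 1: without restriction on divisors the claim is the symmetry of \<open>k\<close> and \<open>l\<close>, and excluding
    the multiples of \<open>s\<close> subtracts from both sides the same count for \<open>N / s\<close>.

  \<^item> For a fixed \<open>k\<close> drop the bound on its multiplicity. The partitions with at least \<open>J\<close> copies of
    \<open>k\<close> are then counted by the \<open>k\<close>-part of \<open>U J\<close>, as a surplus of copies can be removed until
    fewer than \<open>r\<close> remain (\<open>card_one_free_multiplicity\<close>). Multiplicities between \<open>j\<close> and \<open>r - 1\<close>
    are those at least \<open>j\<close> but not at least \<open>r\<close>, so the sum of the \<open>y\<close> statistic is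
    \<open>U j - U r\<close> (\<open>sum_y_stat\<close>).

  Therefore \<open>X - Y = U r\<close> for every \<open>j\<close>. To recognise \<open>U r\<close>, add this up over \<open>j = 1, \<dots>, r - 1\<close>.
  The \<open>x\<close> statistics of a partition without multiples of \<open>r\<close> add up to its number of parts, and so
  do the \<open>y\<close> statistics of a partition with multiplicities below \<open>r\<close>. Each Glaisher operation
  lowers the number of parts by \<open>r - 1\<close>, so the total of \<open>X - Y\<close> is \<open>r - 1\<close> times the number of
  operations (\<open>sum_glaisher_count\<close>), and \<open>U r\<close> is that number.
\<close>

section \<open>Divisors avoiding a list of moduli\<close>

definition avoiding :: "nat list \<Rightarrow> nat set" where
  "avoiding ss = {k. k > 0 \<and> (\<forall>s\<in>set ss. \<not> s dvd k)}"

definition divisor_count :: "nat set \<Rightarrow> (nat \<Rightarrow> nat \<Rightarrow> bool) \<Rightarrow> nat \<Rightarrow> nat" where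
  "divisor_count A H N = card {d \<in> A. d dvd N \<and> H d (N div d)}"

text \<open>The divisors of \<open>N\<close> lost by imposing the extra modulus \<open>s\<close> are the \<open>s * d\<close>, where \<open>d\<close> is a
  divisor of \<open>N / s\<close>; the cofactor of \<open>d\<close> in \<open>N / s\<close> is that of \<open>s * d\<close> in \<open>N\<close>, and by coprimality
  the other moduli see no difference between \<open>d\<close> and \<open>s * d\<close>.\<close>

lemma divisor_count_avoiding_Cons:
  assumes "N > 0" and "s > 0" and cop: "\<And>x. x \<in> set ss \<Longrightarrow> coprime x s"
    and H: "\<And>d e. H (s * d) e = H d e"
  shows "divisor_count (avoiding (s # ss)) H N
       + (if s dvd N then divisor_count (avoiding ss) H (N div s) else 0)
       = divisor_count (avoiding ss) H N"
proof -
  let ?D = "\<lambda>A M. {d \<in> A. d dvd M \<and> H d (M div d)}"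
  let ?T = "{d \<in> ?D (avoiding ss) N. s dvd d}"
  have fin: "finite (?D (avoiding ss) N)"
    using assms(1) by (intro finite_subset[OF _ finite_divisors_nat[of N]]) auto
  have split: "?D (avoiding ss) N = ?D (avoiding (s # ss)) N \<union> ?T"
    by (auto simp: avoiding_def)
  have "card (?D (avoiding ss) N) = card (?D (avoiding (s # ss)) N) + card ?T"
    by (subst split, rule card_Un_disjoint)
      (auto intro!: finite_subset[OF _ fin] simp: avoiding_def)
  moreover have "card ?T = (if s dvd N then card (?D (avoiding ss) (N div s)) else 0)"
  proof (cases "s dvd N")
    case False
    then have "?T = {}" using dvd_trans by blast
    then show ?thesis using False by (metis card.empty)
  next
    case True
    then obtain M where M: "N = s * M" by blast
    have av: "s * d \<in> avoiding ss \<longleftrightarrow> d \<in> avoiding ss" for d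
      using assms(2) cop by (auto simp: avoiding_def coprime_dvd_mult_right_iff)
    have "?T = (\<lambda>d. s * d) ` ?D (avoiding ss) M"
    proof (intro equalityI subsetI)
      fix x assume x: "x \<in> ?T"
      then obtain d where "x = s * d" by blast
      then show "x \<in> (\<lambda>d. s * d) ` ?D (avoiding ss) M"
        using x assms(2) av H by (auto simp: M)
    qed (use assms(2) av H in \<open>auto simp: M\<close>)
    then have "card ?T = card (?D (avoiding ss) M)"
      using assms(2) by (simp only:) (rule card_image, auto simp: inj_on_def)
    then show ?thesis using assms(2) by (simp add: M)
  qed
  ultimately show ?thesis by (simp add: divisor_count_def)
qed

text \<open>Both sides satisfy the recursion \<open>divisor_count_avoiding_Cons\<close>: the condition on the cofactor
  does not involve \<open>s\<close> at all, and the one on the divisor is insensitive to a factor \<open>s\<close> congruent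
  to 1. With no moduli left, the map \<open>d \<mapsto> N div d\<close> exchanges the two sides.\<close>

lemma divisor_count_swap:
  assumes "N > 0" and "\<And>s. s \<in> set ss \<Longrightarrow> s > 0 \<and> [s = 1] (mod r)"
    and "sorted_wrt coprime ss"
  shows "divisor_count (avoiding ss) (\<lambda>d e. [d = j] (mod r)) N
       = divisor_count (avoiding ss) (\<lambda>d e. [e = j] (mod r)) N"
  using assms
proof (induction ss arbitrary: N)
  case Nil
  have "bij_betw (\<lambda>d. N div d)
     {d \<in> avoiding []. d dvd N \<and> [d = j] (mod r)}
     {d \<in> avoiding []. d dvd N \<and> [N div d = j] (mod r)}"
    by (rule bij_betw_byWitness[where f' = "\<lambda>d. N div d"])
      (use Nil in \<open>auto simp: avoiding_def div_div_eq_right dvd_div_iff_mult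
         elim!: dvdE intro: gr0I\<close>)
  then show ?case by (simp add: divisor_count_def bij_betw_same_card)
next
  case (Cons s ss)
  have s: "s > 0" "[s = 1] (mod r)" using Cons.prems(2)[of s] by auto
  have cop: "coprime x s" if "x \<in> set ss" for x
    using that Cons.prems(3) coprime_commute by auto
  have H1: "[s * d = j] (mod r) \<longleftrightarrow> [d = j] (mod r)" for d
  proof -
    have "[s * d = d] (mod r)" using cong_scalar_right[OF s(2), of d] by simp
    then show ?thesis using cong_sym cong_trans by blast
  qed
  have IH': "M > 0 \<Longrightarrow> divisor_count (avoiding ss) (\<lambda>d e. [d = j] (mod r)) M
       = divisor_count (avoiding ss) (\<lambda>d e. [e = j] (mod r)) M" for M
    using Cons.IH[of M] Cons.prems by auto
  have pos: "s dvd N \<Longrightarrow> N div s > 0" using Cons.prems(1) by (auto elim!: dvdE)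
  show ?case
    using divisor_count_avoiding_Cons[where ss = ss and H = "\<lambda>d e. [d = j] (mod r)", OF Cons.prems(1) s(1) cop H1]
      divisor_count_avoiding_Cons[where ss = ss and H = "\<lambda>d e. [e = j] (mod r)", OF Cons.prems(1) s(1) cop refl]
      IH'[OF Cons.prems(1)] IH'[OF pos]
    by (auto split: if_splits)
qed

lemma sum_products_by_divisor_count:
  fixes g :: "nat \<Rightarrow> nat"
  assumes "0 \<notin> A" and "\<And>N. N > n \<Longrightarrow> g N = 0"
  shows "(\<Sum>(k, l) \<in> {(k, l). k \<in> A \<inter> {1..n} \<and> l \<in> {1..n} \<and> H k l}. g (k * l))
       = (\<Sum>N\<in>{1..n}. g N * divisor_count A H N)"
proof -
  let ?T = "{(k, l). k \<in> A \<inter> {1..n} \<and> l \<in> {1..n} \<and> H k l}"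
  let ?S = "{(k, l) \<in> ?T. k * l \<le> n}"
  have finT: "finite ?T" by (rule finite_subset[of _ "{1..n} \<times> {1..n}"]) auto
  then have fin: "finite ?S" by (rule rev_finite_subset) auto
  have "(\<Sum>(k, l)\<in>?T. g (k * l)) = (\<Sum>(k, l)\<in>?S. g (k * l))"
    by (rule sum.mono_neutral_right[OF finT]) (use assms(2) in \<open>auto simp flip: not_less\<close>)
  also have "\<dots> = (\<Sum>N\<in>{1..n}. \<Sum>(k, l)\<in>{z \<in> ?S. fst z * snd z = N}. g (k * l))"
    by (rule sum.group[symmetric]) (use fin in auto)
  also have "\<dots> = (\<Sum>N\<in>{1..n}. g N * divisor_count A H N)"
  proof (rule sum.cong[OF refl])
    fix N assume N: "N \<in> {1..n}"
    let ?F = "{z \<in> ?S. fst z * snd z = N}"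
    have "?F = (\<lambda>d. (d, N div d)) ` {d \<in> A. d dvd N \<and> H d (N div d)}"
    proof (intro equalityI subsetI)
      fix z assume "z \<in> (\<lambda>d. (d, N div d)) ` {d \<in> A. d dvd N \<and> H d (N div d)}"
      then obtain d where d: "z = (d, N div d)" "d \<in> A" "d dvd N" "H d (N div d)" by blast
      then have "d * (N div d) = N" by simp
      moreover from this have "d \<ge> 1" "N div d \<ge> 1" using N
        by (metis One_nat_def Suc_leI atLeastAtMost_iff bot_nat_0.not_eq_extremum
              mult_is_0 not_one_le_zero)+
      moreover have "d \<le> n" "N div d \<le> n"
        using N dvd_imp_le[OF d(3)] le_trans[OF div_le_dividend, of N n d] by auto
      ultimately show "z \<in> ?F" using d N by auto
    qed auto
    then have "card ?F = divisor_count A H N"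
      unfolding divisor_count_def by (simp only:) (rule card_image, auto simp: inj_on_def)
    moreover have "(\<Sum>(k, l)\<in>?F. g (k * l)) = (\<Sum>z\<in>?F. g N)" by (rule sum.cong) auto
    ultimately show "(\<Sum>(k, l)\<in>?F. g (k * l)) = g N * divisor_count A H N"
      by simp
  qed
  finally show ?thesis .
qed

section \<open>Glaisher's bijection\<close>

text \<open>Undoing Glaisher operations on a part \<open>k\<close> for as long as possible ends with equal copies of
  \<open>k / r ^ i\<close>, where \<open>r ^ i\<close> is the largest power of \<open>r\<close> dividing \<open>k\<close>.\<close>

definition split_part :: "nat \<Rightarrow> nat \<Rightarrow> nat multiset" where
  "split_part r k = replicate_mset (r ^ multiplicity r k) (k div r ^ multiplicity r k)"

definition flatten :: "nat \<Rightarrow> nat multiset \<Rightarrow> nat multiset" where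
  "flatten r \<rho> = (\<Sum>k\<in>#\<rho>. split_part r k)"

lemma flatten_simps [simp]:
  "flatten r {#} = {#}"
  "flatten r (add_mset k \<rho>) = split_part r k + flatten r \<rho>"
  "flatten r (\<rho> + \<sigma>) = flatten r \<rho> + flatten r \<sigma>"
  by (simp_all add: flatten_def)

lemma replicate_mset_plus: "replicate_mset (a + b) k = replicate_mset a k + replicate_mset b k"
  by (induction a) auto

lemma sum_mset_split_part: "\<Sum>\<^sub># (split_part r k) = k"
  by (simp add: split_part_def multiplicity_dvd)

lemma sum_mset_flatten: "\<Sum>\<^sub># (flatten r \<rho>) = \<Sum>\<^sub># \<rho>"
  by (induction \<rho>) (auto simp: sum_mset_split_part)

lemma flatten_ident:
  assumes "\<And>k. k \<in># \<rho> \<Longrightarrow> \<not> r dvd k"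
  shows "flatten r \<rho> = \<rho>"
  using assms by (induction \<rho>) (auto simp: split_part_def not_dvd_imp_multiplicity_0)

lemma in_flatten:
  assumes "r \<ge> 2" and "p \<in># flatten r \<rho>" and "0 \<notin># \<rho>"
  obtains i where "r ^ i * p \<in># \<rho>" and "\<not> r dvd p"
proof -
  from assms(2) obtain k where k: "k \<in># \<rho>" "p \<in># split_part r k"
    by (induction \<rho>) auto
  then have p: "p = k div r ^ multiplicity r k" by (auto simp: split_part_def split: if_splits)
  then have e: "r ^ multiplicity r k * p = k" by (simp add: multiplicity_dvd)
  have "k \<noteq> 0" using k(1) assms(3) by metis
  then have "\<not> r dvd p" unfolding p
    using multiplicity_decompose[of k r] assms(1) by auto
  then show ?thesis using that[of "multiplicity r k"] e k(1) by simp
qed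

text \<open>The full splitting is an invariant of the operations, because \<open>r\<close> copies of \<open>k\<close> and one copy of
  \<open>r * k\<close> split into the same parts. Zero must be excluded: it equals \<open>r * 0\<close>, so an operation on it
  would change the splitting.\<close>

lemma glaisher_step_flatten:
  assumes "r \<ge> 2" and "0 \<notin># \<rho>" and "glaisher_step r \<rho> \<mu>"
  shows "flatten r \<mu> = flatten r \<rho>" and "\<Sum>\<^sub># \<mu> = \<Sum>\<^sub># \<rho>" and "size \<rho> = size \<mu> + (r - 1)"
    and "0 \<notin># \<mu>" and "\<And>p. p \<in># \<mu> \<Longrightarrow> p \<in># \<rho> \<or> (\<exists>k\<in>#\<rho>. p = r * k)"
proof -
  from assms(3) obtain k where k: "count \<rho> k \<ge> r"
    and \<mu>: "\<mu> = \<rho> - replicate_mset r k + {#r * k#}" by cases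
  define \<sigma> where "\<sigma> = \<rho> - replicate_mset r k"
  have \<rho>: "\<rho> = \<sigma> + replicate_mset r k"
    using k by (simp add: \<sigma>_def count_le_replicate_mset_subset_eq)
  have \<mu>': "\<mu> = add_mset (r * k) \<sigma>" by (simp add: \<mu> \<sigma>_def)
  have "k \<in># \<rho>" using assms(1) by (simp add: \<rho>)
  then have k0: "k > 0" using assms(2) by (metis gr0I)
  have "flatten r (replicate_mset m k) = replicate_mset (m * r ^ multiplicity r k) (k div r ^ multiplicity r k)" for m
    by (induction m) (simp_all add: split_part_def replicate_mset_plus)
  moreover have "split_part r (r * k) = replicate_mset (r * r ^ multiplicity r k) (k div r ^ multiplicity r k)"
    using k0 assms(1) by (simp add: split_part_def multiplicity_times_same)
  ultimately show "flatten r \<mu> = flatten r \<rho>" by (simp add: \<rho> \<mu>')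
  show "\<Sum>\<^sub># \<mu> = \<Sum>\<^sub># \<rho>" by (simp add: \<rho> \<mu>')
  show "size \<rho> = size \<mu> + (r - 1)" using assms(1) by (simp add: \<rho> \<mu>')
  show "0 \<notin># \<mu>" using assms(1,2) k0 by (auto simp: \<rho> \<mu>')
  show "p \<in># \<rho> \<or> (\<exists>k\<in>#\<rho>. p = r * k)" if "p \<in># \<mu>" for p
    using that \<open>k \<in># \<rho>\<close> by (auto simp: \<mu>' \<rho>)
qed

lemma glaisher_run_invariants:
  assumes "r \<ge> 2" and "(glaisher_step r ^^ t) \<rho> \<mu>" and "0 \<notin># \<rho>"
    and "\<And>k. k \<in> A \<Longrightarrow> r * k \<in> A" and "set_mset \<rho> \<subseteq> A"
  shows "flatten r \<mu> = flatten r \<rho> \<and> \<Sum>\<^sub># \<mu> = \<Sum>\<^sub># \<rho> \<and> size \<rho> = size \<mu> + t * (r - 1)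
       \<and> set_mset \<mu> \<subseteq> A"
  using assms(2,3,5)
proof (induction t arbitrary: \<rho>)
  case 0
  then show ?case by simp
next
  case (Suc t)
  from Suc.prems(1) obtain \<nu> where n: "glaisher_step r \<rho> \<nu>" "(glaisher_step r ^^ t) \<nu> \<mu>"
    by (meson relpowp_Suc_D2)
  note st = glaisher_step_flatten[OF assms(1) Suc.prems(2) n(1)]
  have "set_mset \<nu> \<subseteq> A" using st(5) Suc.prems(3) assms(4) by blast
  from Suc.IH[OF n(2) st(4) this] show ?case using st(1-3) by simp
qed

lemma glaisher_run_add_right:
  assumes "(glaisher_step r)\<^sup>*\<^sup>* \<rho> \<mu>"
  shows "(glaisher_step r)\<^sup>*\<^sup>* (\<rho> + \<sigma>) (\<mu> + \<sigma>)"
  using assms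
proof induction
  case (step \<mu> \<nu>)
  from step.hyps(2) have "glaisher_step r (\<mu> + \<sigma>) (\<nu> + \<sigma>)"
  proof cases
    case (1 k)
    have "\<nu> + \<sigma> = (\<mu> + \<sigma>) - replicate_mset r k + {#r * k#}"
      using 1 by (intro multiset_eqI) auto
    then show ?thesis using 1(2) by (metis glaisher_step.intros count_union trans_le_add1)
  qed
  then show ?case using step.IH by simp
qed simp

lemma glaisher_run_add:
  assumes "(glaisher_step r)\<^sup>*\<^sup>* \<rho> \<mu>" and "(glaisher_step r)\<^sup>*\<^sup>* \<rho>' \<mu>'"
  shows "(glaisher_step r)\<^sup>*\<^sup>* (\<rho> + \<rho>') (\<mu> + \<mu>')"
  using glaisher_run_add_right[OF assms(1), of \<rho>'] glaisher_run_add_right[OF assms(2), of \<mu>]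
  by (metis add.commute rtranclp_trans)

lemma glaisher_run_replicate:
  "(glaisher_step r)\<^sup>*\<^sup>* (replicate_mset (m * r ^ i) p) (replicate_mset m (r ^ i * p))"
proof (induction i arbitrary: m)
  case (Suc i)
  have one: "(glaisher_step r)\<^sup>*\<^sup>* (replicate_mset r k) {#r * k#}" for k
    using glaisher_step.intros[of r "replicate_mset r k" k] by auto
  have many: "(glaisher_step r)\<^sup>*\<^sup>* (replicate_mset (m * r) k) (replicate_mset m (r * k))" for k
  proof (induction m)
    case (Suc m)
    from glaisher_run_add[OF one Suc, of k]
    show ?case by (simp add: replicate_mset_plus)
  qed simp
  show ?case using rtranclp_trans[OF Suc[of "m * r"] many] by (simp add: mult_ac)
qed simp

text \<open>Each splitting can be reversed by operations. As the end of a run is determined by its start,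
  this makes \<open>flatten\<close> injective on the partitions where runs end.\<close>

lemma glaisher_run_from_flatten: "(glaisher_step r)\<^sup>*\<^sup>* (flatten r \<mu>) \<mu>"
proof (induction \<mu>)
  case (add k \<mu>)
  have "(glaisher_step r)\<^sup>*\<^sup>* (split_part r k) {#k#}"
    using glaisher_run_replicate[of r 1 "multiplicity r k" "k div r ^ multiplicity r k"]
    by (simp add: split_part_def multiplicity_dvd)
  from glaisher_run_add[OF this add] show ?case by simp
qed simp

lemma glaisher_count_flatten:
  assumes "r \<ge> 2" and "\<mu> \<in> RP r"
  shows "glaisher_count r (flatten r \<mu>) * (r - 1) + size \<mu> = size (flatten r \<mu>)"
proof -
  have "0 \<notin># \<mu>" using assms(2) by (auto simp: RP_def partitions_def)
  then have z: "0 \<notin># flatten r \<mu>" using in_flatten[OF assms(1)] by (metis mult_0_right)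
  obtain t where t: "(glaisher_step r ^^ t) (flatten r \<mu>) \<mu>"
    using glaisher_run_from_flatten[of r \<mu>] by (meson rtranclp_imp_relpowp)
  then have "glaisher_count r (flatten r \<mu>) = t"
    unfolding glaisher_count_def
    using assms(2) glaisher_run_unique[OF assms(1)] by (intro the_equality) blast+
  then show ?thesis
    using glaisher_run_invariants[OF assms(1) t z, of UNIV] by simp
qed

section \<open>Partitions with parts in a prescribed set\<close>

definition parts_from :: "nat set \<Rightarrow> nat \<Rightarrow> nat multiset set" where
  "parts_from A n = {\<rho>. set_mset \<rho> \<subseteq> A \<and> \<Sum>\<^sub># \<rho> = n}"

lemma finite_parts_from: "0 \<notin> A \<Longrightarrow> finite (parts_from A n)"
  by (rule finite_subset[OF _ finite_of_size_partitions[of n]])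
    (auto simp: parts_from_def of_size_def partitions_def Suc_le_eq intro!: gr0I)

lemma count_times_part_le: "count \<rho> k * k \<le> \<Sum>\<^sub># (\<rho> :: nat multiset)"
proof -
  have "replicate_mset (count \<rho> k) k \<subseteq># \<rho>" by (simp add: count_le_replicate_mset_subset_eq[symmetric])
  then obtain \<sigma> where "\<rho> = replicate_mset (count \<rho> k) k + \<sigma>" by (metis mset_subset_eqD subset_mset.le_iff_add)
  then show ?thesis by (metis sum_mset_replicate_mset of_nat_id sum_mset.union le_add1)
qed

text \<open>Running Glaisher's operations is inverse to \<open>flatten\<close>: a run from \<open>\<rho>\<close> to \<open>\<mu>\<close> preserves the
  splitting, and a \<open>\<rho>\<close> without multiples of \<open>r\<close> is its own splitting.\<close>

lemma bij_flatten:
  assumes r: "r \<ge> 2" and A0: "0 \<notin> A" and A: "\<And>k. r * k \<in> A \<longleftrightarrow> k \<in> A"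
  shows "bij_betw (flatten r) {\<mu> \<in> parts_from A n. \<forall>k. count \<mu> k < r}
           (parts_from {k \<in> A. \<not> r dvd k} n)"
proof -
  let ?R = "{\<mu> \<in> parts_from A n. \<forall>k. count \<mu> k < r}"
  have RP: "\<mu> \<in> RP r" if "\<mu> \<in> ?R" for \<mu>
    using that A0 by (auto simp: parts_from_def RP_def partitions_def Suc_le_eq intro!: gr0I)
  have Apow: "r ^ i * p \<in> A \<longleftrightarrow> p \<in> A" for i p
    by (induction i) (auto simp: A mult.assoc)
  show ?thesis
  proof (rule bij_betwI')
    fix \<mu> \<nu> assume m: "\<mu> \<in> ?R" and n: "\<nu> \<in> ?R"
    show "flatten r \<mu> = flatten r \<nu> \<longleftrightarrow> \<mu> = \<nu>"
    proof
      assume "flatten r \<mu> = flatten r \<nu>"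
      then show "\<mu> = \<nu>"
        using glaisher_run_from_flatten[of r \<mu>] glaisher_run_from_flatten[of r \<nu>]
          glaisher_run_unique[OF r RP[OF m] RP[OF n]]
        by (metis rtranclp_imp_relpowp)
    qed simp
  next
    fix \<mu> assume m: "\<mu> \<in> ?R"
    then have "0 \<notin># \<mu>" using A0 by (auto simp: parts_from_def)
    then show "flatten r \<mu> \<in> parts_from {k \<in> A. \<not> r dvd k} n"
      using m Apow by (auto simp: parts_from_def sum_mset_flatten elim!: in_flatten[OF r])
  next
    fix \<rho> assume p: "\<rho> \<in> parts_from {k \<in> A. \<not> r dvd k} n"
    then have z: "0 \<notin># \<rho>" and sub: "set_mset \<rho> \<subseteq> A" using A0 by (auto simp: parts_from_def)
    then have "\<rho> \<in> partitions" by (auto simp: partitions_def Suc_le_eq intro!: gr0I)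
    then obtain t \<mu> where t: "\<mu> \<in> RP r" "(glaisher_step r ^^ t) \<rho> \<mu>"
      using glaisher_run_exists[OF r] by blast
    have inv: "flatten r \<mu> = flatten r \<rho>" "\<Sum>\<^sub># \<mu> = \<Sum>\<^sub># \<rho>" "set_mset \<mu> \<subseteq> A"
      using glaisher_run_invariants[OF r t(2) z _ sub] A by auto
    have "flatten r \<rho> = \<rho>" using p by (intro flatten_ident) (auto simp: parts_from_def)
    moreover have "count \<mu> k < r" for k
    proof (cases "k = 0")
      case True
      then have "k \<notin># \<mu>" using inv(3) A0 by auto
      then show ?thesis using r by (simp add: not_in_iff)
    next
      case False
      then show ?thesis using t(1) by (auto simp: RP_def)
    qed
    ultimately show "\<exists>\<mu>\<in>?R. \<rho> = flatten r \<mu>"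
      using inv p by (auto simp: parts_from_def intro!: bexI[of _ \<mu>])
  qed
qed

text \<open>The predicate \<open>P\<close> restricts what is left after the removal, so the lemma serves both for
  unrestricted partitions and for bounded multiplicities.\<close>

lemma card_remove_copies:
  assumes "k \<in> A"
  shows "card {\<rho> \<in> parts_from A n. l \<le> count \<rho> k \<and> P (\<rho> - replicate_mset l k)}
       = (if k * l \<le> n then card {\<sigma> \<in> parts_from A (n - k * l). P \<sigma>} else 0)"
proof (cases "k * l \<le> n")
  case True
  have "bij_betw (\<lambda>\<rho>. \<rho> - replicate_mset l k)
     {\<rho> \<in> parts_from A n. l \<le> count \<rho> k \<and> P (\<rho> - replicate_mset l k)}
     {\<sigma> \<in> parts_from A (n - k * l). P \<sigma>}"
  proof (rule bij_betw_byWitness[where f' = "\<lambda>\<sigma>. \<sigma> + replicate_mset l k"])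
    show "(\<lambda>\<rho>. \<rho> - replicate_mset l k) `
        {\<rho> \<in> parts_from A n. l \<le> count \<rho> k \<and> P (\<rho> - replicate_mset l k)}
      \<subseteq> {\<sigma> \<in> parts_from A (n - k * l). P \<sigma>}"
    proof (clarsimp simp: parts_from_def)
      fix \<rho> assume "l \<le> count \<rho> k" "set_mset \<rho> \<subseteq> A"
      then obtain \<sigma> where "\<rho> = \<sigma> + replicate_mset l k"
        by (metis count_le_replicate_mset_subset_eq subset_mset.diff_add)
      then show "set_mset (\<rho> - replicate_mset l k) \<subseteq> A \<and>
          \<Sum>\<^sub># (\<rho> - replicate_mset l k) = \<Sum>\<^sub># \<rho> - k * l"
        using \<open>set_mset \<rho> \<subseteq> A\<close> by simp
    qed
  qed (use assms True in \<open>auto simp: parts_from_def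
         count_le_replicate_mset_subset_eq split: if_splits\<close>)
  then show ?thesis using True by (simp add: bij_betw_same_card)
next
  case False
  have "\<not> l \<le> count \<rho> k" if "\<rho> \<in> parts_from A n" for \<rho>
  proof
    assume "l \<le> count \<rho> k"
    from mult_le_mono2[OF this, of k] have "k * l \<le> count \<rho> k * k" by (simp only: mult.commute)
    moreover have "count \<rho> k * k \<le> n"
      using that count_times_part_le[of \<rho> k] by (simp add: parts_from_def)
    ultimately show False using False by (metis le_trans)
  qed
  then show ?thesis using False by (auto simp: card_eq_0_iff)
qed

section \<open>Both statistics as sums over products\<close>

text \<open>The value 0 beyond \<open>n\<close> is the number of partitions of a negative number; truncated subtraction
  alone would count the empty partition of 0 there.\<close>

definition core_count :: "nat set \<Rightarrow> nat \<Rightarrow> nat \<Rightarrow> nat \<Rightarrow> nat" where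
  "core_count A r n N = (if N \<le> n then card (parts_from {k \<in> A. \<not> r dvd k} (n - N)) else 0)"

lemma sum_card_swap:
  assumes "finite F" and "finite T"
  shows "(\<Sum>\<rho>\<in>F. card {z \<in> T. Q \<rho> z}) = (\<Sum>z\<in>T. card {\<rho> \<in> F. Q \<rho> z})"
  using assms by (rule sum_multicount_gen) simp

lemma parts_from_bounds:
  assumes "\<rho> \<in> parts_from A n" and "0 \<notin> A" and "k \<in># \<rho>"
  shows "k \<in> A \<inter> {1..n}" and "count \<rho> k \<le> n"
proof -
  have k: "k \<in> A" "k > 0" using assms by (auto simp: parts_from_def intro: gr0I)
  have "count \<rho> k * k \<le> n" using assms(1) count_times_part_le[of \<rho> k] by (simp add: parts_from_def)
  moreover have "count \<rho> k \<ge> 1" using assms(3) by simp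
  ultimately show "k \<in> A \<inter> {1..n}" "count \<rho> k \<le> n"
    using k by (auto elim!: order_trans[rotated])
qed

text \<open>A pair \<open>(k, l)\<close> with \<open>l \<le> count \<rho> k\<close> stands for the \<open>l\<close>-th copy of the part \<open>k\<close>. Since \<open>j\<close> is not
  divisible by \<open>r\<close>, every \<open>k\<close> congruent to \<open>j\<close> is an admissible part as soon as it lies in \<open>A\<close>, so
  no trace of the condition \<open>\<not> r dvd k\<close> remains in the range of summation.\<close>

lemma sum_x_stat:
  assumes A0: "0 \<notin> A" and j: "1 \<le> j" "j < r"
  shows "(\<Sum>\<rho>\<in>parts_from {k \<in> A. \<not> r dvd k} n. x_stat r j \<rho>)
       = (\<Sum>(k, l) \<in> {(k, l). k \<in> A \<inter> {1..n} \<and> l \<in> {1..n} \<and> [k = j] (mod r)}. core_count A r n (k * l))"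
proof -
  let ?B = "{k \<in> A. \<not> r dvd k}"
  let ?T = "{(k, l). k \<in> A \<inter> {1..n} \<and> l \<in> {1..n} \<and> [k = j] (mod r)}"
  have finT: "finite ?T" by (rule finite_subset[of _ "{1..n} \<times> {1..n}"]) auto
  have B: "k \<in> ?B" if "k \<in> A" "[k = j] (mod r)" for k
    using that j by (auto simp: cong_def mod_eq_0_iff_dvd[symmetric])
  have x: "x_stat r j \<rho> = card {z \<in> ?T. snd z \<le> count \<rho> (fst z)}" if p: "\<rho> \<in> parts_from ?B n" for \<rho>
  proof -
    have bnd: "k \<in> A \<inter> {1..n} \<and> count \<rho> k \<le> n" if "k \<in># \<rho>" for k
      using parts_from_bounds[OF p _ that] A0 by auto
    have "{z \<in> ?T. snd z \<le> count \<rho> (fst z)}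
        = (SIGMA k:set_mset {#p \<in># \<rho>. [p = j] (mod r)#}. {1..count \<rho> k})"
      using bnd by (fastforce simp: Suc_le_eq intro: count_inI)
    then show ?thesis by (simp add: x_stat_def size_multiset_overloaded_eq)
  qed
  have "(\<Sum>\<rho>\<in>parts_from ?B n. x_stat r j \<rho>)
      = (\<Sum>\<rho>\<in>parts_from ?B n. card {z \<in> ?T. snd z \<le> count \<rho> (fst z)})"
    by (rule sum.cong) (auto simp: x)
  also have "\<dots> = (\<Sum>z\<in>?T. card {\<rho> \<in> parts_from ?B n. snd z \<le> count \<rho> (fst z)})"
    using finT A0 by (intro sum_card_swap finite_parts_from) auto
  also have "\<dots> = (\<Sum>(k, l)\<in>?T. core_count A r n (k * l))"
  proof (rule sum.cong[OF refl])
    fix z assume z: "z \<in> ?T"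
    then have "fst z \<in> ?B" using B by auto
    from card_remove_copies[OF this, of n "snd z" "\<lambda>_. True"]
    show "card {\<rho> \<in> parts_from ?B n. snd z \<le> count \<rho> (fst z)} = (case z of (k, l) \<Rightarrow> core_count A r n (k * l))"
      by (simp add: core_count_def split_beta)
  qed
  finally show ?thesis .
qed

text \<open>A multiplicity \<open>M \<ge> J\<close> is uniquely \<open>l + i\<close> with \<open>l\<close> congruent to \<open>J\<close>, \<open>l \<ge> J\<close> and \<open>0 \<le> i < r\<close>.
  Removing \<open>l\<close> copies of \<open>k\<close> leaves a partition with all multiplicities below \<open>r\<close>, and those are
  counted by \<open>core_count\<close> through Glaisher's bijection. As \<open>1 \<le> J \<le> r\<close>, the condition \<open>l \<ge> J\<close>
  follows from \<open>l \<ge> 1\<close> and the congruence; the value \<open>J = r\<close> is the one that corrects for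
  multiplicities that are too large.\<close>

lemma card_one_free_multiplicity:
  assumes r: "r \<ge> 2" and A0: "0 \<notin> A" and A: "\<And>k. r * k \<in> A \<longleftrightarrow> k \<in> A"
    and J: "1 \<le> J" "J \<le> r" and k: "k \<in> A"
  shows "card {\<rho> \<in> parts_from A n. (\<forall>i. i \<noteq> k \<longrightarrow> count \<rho> i < r) \<and> J \<le> count \<rho> k}
       = (\<Sum>l | l \<in> {1..n} \<and> [l = J] (mod r). core_count A r n (k * l))"
proof -
  let ?Q = "{\<rho> \<in> parts_from A n. (\<forall>i. i \<noteq> k \<longrightarrow> count \<rho> i < r) \<and> J \<le> count \<rho> k}"
  let ?T = "{l. l \<in> {1..n} \<and> [l = J] (mod r)}"
  \<comment> \<open>the largest number congruent to \<open>J\<close> that does not exceed the multiplicity of \<open>k\<close>\<close>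
  let ?f = "\<lambda>\<rho>. count \<rho> k - (count \<rho> k - J) mod r"
  have fin: "finite ?Q" using finite_parts_from[OF A0, of n] by simp
  have Jl: "J \<le> l" if "[l = J] (mod r)" "l \<ge> 1" for l
  proof (rule ccontr)
    assume "\<not> J \<le> l"
    moreover from this have "r dvd J - l"
      using that(1) by (simp add: cong_altdef_nat cong_sym_eq[of l])
    ultimately have "r \<le> J - l" by (intro dvd_imp_le) auto
    then show False using J that(2) by simp
  qed
  have f_eq: "M - (M - J) mod r = J + r * ((M - J) div r)" if "J \<le> M" for M
    using that mult_div_mod_eq[of r "M - J"] by linarith
  have f: "?f \<rho> = l \<longleftrightarrow> l \<le> count \<rho> k \<and> count \<rho> k < l + r"
    if "J \<le> count \<rho> k" "[l = J] (mod r)" "l \<ge> 1" for \<rho> l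
  proof -
    define M b where "M = count \<rho> k" and "b = M - J"
    have b: "M = J + b" using that(1) by (simp add: M_def b_def)
    have e: "M - (M - J) mod r = J + r * (b div r)"
      using f_eq[of M] that(1) by (simp add: M_def b_def)
    have "r dvd l - J" using that(2) Jl[OF that(2,3)] by (simp add: cong_altdef_nat)
    then obtain a where "l - J = r * a" by blast
    then have a: "l = J + r * a" using Jl[OF that(2,3)] by linarith
    show ?thesis unfolding M_def[symmetric] e
    proof
      assume "J + r * (b div r) = l"
      then show "l \<le> M \<and> M < l + r" unfolding b
        using r mult_div_mod_eq[of r b] mod_less_divisor[of r b] by linarith
    next
      assume "l \<le> M \<and> M < l + r"
      then have "r * a \<le> b" "b < r * a + r" using a b by auto
      then have "b div r = a" using r by (intro div_nat_eqI) (auto simp: algebra_simps)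
      then show "J + r * (b div r) = l" using a by simp
    qed
  qed
  have fT: "?f \<rho> \<in> ?T" if "\<rho> \<in> ?Q" for \<rho>
  proof -
    define M where "M = count \<rho> k"
    have e: "M - (M - J) mod r = J + r * ((M - J) div r)"
      using that by (intro f_eq) (simp add: M_def)
    have "k \<in># \<rho>" using that J by (auto intro: count_inI)
    then have "M \<le> n" using that parts_from_bounds[OF _ A0] unfolding M_def by blast
    then have "M - (M - J) mod r \<le> n" by simp
    then show ?thesis using J unfolding M_def[symmetric] e by (simp add: cong_def)
  qed
  have "card ?Q = (\<Sum>\<rho>\<in>?Q. 1)" by simp
  also have "\<dots> = (\<Sum>l\<in>?T. \<Sum>\<rho>\<in>{\<rho> \<in> ?Q. ?f \<rho> = l}. 1)"
    by (rule sum.group[symmetric, OF fin]) (use fT in auto)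
  also have "\<dots> = (\<Sum>l\<in>?T. card {\<rho> \<in> ?Q. ?f \<rho> = l})" by simp
  also have "\<dots> = (\<Sum>l\<in>?T. core_count A r n (k * l))"
  proof (rule sum.cong[OF refl])
    fix l assume l: "l \<in> ?T"
    let ?P = "\<lambda>\<sigma>. \<forall>i. count \<sigma> i < r"
    have "{\<rho> \<in> ?Q. ?f \<rho> = l} = {\<rho> \<in> parts_from A n. l \<le> count \<rho> k \<and> ?P (\<rho> - replicate_mset l k)}"
      (is "?L = ?R")
    proof (intro equalityI subsetI)
      fix \<rho> assume p: "\<rho> \<in> ?L"
      then have "l \<le> count \<rho> k \<and> count \<rho> k < l + r" using f[of \<rho> l] l by auto
      then show "\<rho> \<in> ?R" using p by auto
    next
      fix \<rho> assume p: "\<rho> \<in> ?R"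
      then have a: "count (\<rho> - replicate_mset l k) i < r" for i by blast
      have "count \<rho> k < l + r" using a[of k] p by auto
      moreover have "count \<rho> i < r" if "i \<noteq> k" for i using a[of i] that by simp
      ultimately show "\<rho> \<in> ?L" using p f[of \<rho> l] l Jl[of l] by auto
    qed
    then have "card {\<rho> \<in> ?Q. ?f \<rho> = l}
        = (if k * l \<le> n then card {\<sigma> \<in> parts_from A (n - k * l). ?P \<sigma>} else 0)"
      using card_remove_copies[OF k, of n l ?P] by simp
    then show "card {\<rho> \<in> ?Q. ?f \<rho> = l} = core_count A r n (k * l)"
      by (simp only: core_count_def bij_betw_same_card[OF bij_flatten[OF r A0 A]])
  qed
  finally show ?thesis .
qed

text \<open>Between \<open>j\<close> and \<open>r - 1\<close> copies of \<open>k\<close> means at least \<open>j\<close> but not at least \<open>r\<close>, and once the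
  bound on the multiplicity of \<open>k\<close> is dropped, \<open>card_one_free_multiplicity\<close> counts both.\<close>

lemma sum_y_stat:
  assumes r: "r \<ge> 2" and A0: "0 \<notin> A" and A: "\<And>k. r * k \<in> A \<longleftrightarrow> k \<in> A"
    and j: "1 \<le> j" "j < r"
  shows "(\<Sum>\<mu> | \<mu> \<in> parts_from A n \<and> (\<forall>k. count \<mu> k < r). y_stat j \<mu>)
       + (\<Sum>(k, l) \<in> {(k, l). k \<in> A \<inter> {1..n} \<and> l \<in> {1..n} \<and> [l = r] (mod r)}. core_count A r n (k * l))
       = (\<Sum>(k, l) \<in> {(k, l). k \<in> A \<inter> {1..n} \<and> l \<in> {1..n} \<and> [l = j] (mod r)}. core_count A r n (k * l))"
proof -
  let ?R = "{\<mu>. \<mu> \<in> parts_from A n \<and> (\<forall>k. count \<mu> k < r)}"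
  let ?K = "A \<inter> {1..n}"
  let ?Q = "\<lambda>J k. {\<rho> \<in> parts_from A n. (\<forall>i. i \<noteq> k \<longrightarrow> count \<rho> i < r) \<and> J \<le> count \<rho> k}"
  have fin: "finite (parts_from A n)" by (rule finite_parts_from[OF A0])
  have dbl: "(\<Sum>(k, l) \<in> {(k, l). k \<in> ?K \<and> l \<in> {1..n} \<and> [l = J] (mod r)}. core_count A r n (k * l))
      = (\<Sum>k\<in>?K. card (?Q J k))" if "1 \<le> J" "J \<le> r" for J
  proof -
    have "{(k, l). k \<in> ?K \<and> l \<in> {1..n} \<and> [l = J] (mod r)} = ?K \<times> {l. l \<in> {1..n} \<and> [l = J] (mod r)}"
      by auto
    then show ?thesis
      using card_one_free_multiplicity[OF r A0 A that] by (simp add: sum.cartesian_product[symmetric])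
  qed
  have y: "y_stat j \<mu> = card {k \<in> ?K. j \<le> count \<mu> k}" if "\<mu> \<in> ?R" for \<mu>
  proof -
    have "k \<in> ?K" if k: "j \<le> count \<mu> k" for k
    proof -
      have "0 < count \<mu> k" using k j(1) by linarith
      then have "k \<in># \<mu>" by (rule count_greater_zero_iff[THEN iffD1])
      then show ?thesis using parts_from_bounds(1)[OF _ A0, of \<mu> n k] that \<open>\<mu> \<in> ?R\<close> by auto
    qed
    then show ?thesis unfolding y_stat_def by (intro arg_cong[of _ _ card]) auto
  qed
  have "(\<Sum>\<mu>\<in>?R. y_stat j \<mu>) = (\<Sum>\<mu>\<in>?R. card {k \<in> ?K. j \<le> count \<mu> k})"
    by (rule sum.cong) (auto simp: y)
  also have "\<dots> = (\<Sum>k\<in>?K. card {\<mu> \<in> ?R. j \<le> count \<mu> k})"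
    using fin by (intro sum_card_swap) auto
  finally have Y: "(\<Sum>\<mu>\<in>?R. y_stat j \<mu>) = (\<Sum>k\<in>?K. card {\<mu> \<in> ?R. j \<le> count \<mu> k})" .
  have "card {\<mu> \<in> ?R. j \<le> count \<mu> k} + card (?Q r k) = card (?Q j k)" for k
  proof -
    have "?Q j k = {\<mu> \<in> ?R. j \<le> count \<mu> k} \<union> ?Q r k"
      using j by (auto simp: not_less)
    moreover have "{\<mu> \<in> ?R. j \<le> count \<mu> k} \<inter> ?Q r k = {}" by (auto simp: not_le[symmetric])
    ultimately show ?thesis using fin by (simp add: card_Un_disjoint)
  qed
  then show ?thesis using dbl[of r] dbl[of j] j r unfolding Y by (simp add: sum.distrib[symmetric])
qed

section \<open>Summation over the residues\<close>

lemma size_eq_sum_x_stat: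
  assumes "r \<ge> 2" and "\<And>k. k \<in># \<rho> \<Longrightarrow> \<not> r dvd k"
  shows "size \<rho> = (\<Sum>j\<in>{1..<r}. x_stat r j \<rho>)"
  using assms(2)
proof (induction \<rho>)
  case (add k \<rho>)
  have "{j \<in> {1..<r}. [k = j] (mod r)} = {k mod r}"
    using add.prems[of k] assms(1) by (auto simp: cong_def mod_greater_zero_iff_not_dvd Suc_le_eq)
  then have "(\<Sum>j\<in>{1..<r}. of_bool [k = j] (mod r)) = (1::nat)"
    by (simp add: Int_def)
  moreover have "x_stat r j (add_mset k \<rho>) = of_bool [k = j] (mod r) + x_stat r j \<rho>" for j
    by (simp add: x_stat_def)
  ultimately show ?case using add by (simp add: sum.distrib)
qed (simp add: x_stat_def)

lemma size_eq_sum_y_stat: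
  assumes "0 \<notin># \<mu>" and "\<And>k. count \<mu> k < r"
  shows "size \<mu> = (\<Sum>j\<in>{1..<r}. y_stat j \<mu>)"
proof -
  have "(\<Sum>j\<in>{1..<r}. y_stat j \<mu>) = (\<Sum>j\<in>{1..<r}. card {k \<in> set_mset \<mu>. j \<le> count \<mu> k})"
  proof (rule sum.cong[OF refl])
    fix j assume "j \<in> {1..<r}"
    then have "{k. k \<ge> 1 \<and> count \<mu> k \<ge> j} = {k \<in> set_mset \<mu>. j \<le> count \<mu> k}"
      using assms(1) by (auto simp: Suc_le_eq intro: count_inI intro!: gr0I)
    then show "y_stat j \<mu> = card {k \<in> set_mset \<mu>. j \<le> count \<mu> k}" by (simp add: y_stat_def)
  qed
  also have "\<dots> = (\<Sum>k\<in>set_mset \<mu>. card {j \<in> {1..<r}. j \<le> count \<mu> k})"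
    by (rule sum_card_swap) auto
  also have "\<dots> = (\<Sum>k\<in>set_mset \<mu>. count \<mu> k)"
  proof (rule sum.cong[OF refl])
    fix k
    have "{j \<in> {1..<r}. j \<le> count \<mu> k} = {1..count \<mu> k}" using assms(2)[of k] by auto
    then show "card {j \<in> {1..<r}. j \<le> count \<mu> k} = count \<mu> k" by simp
  qed
  finally show ?thesis by (simp add: size_multiset_overloaded_eq)
qed

text \<open>By \<open>glaisher_count_flatten\<close>, \<open>r - 1\<close> times the number of operations is the difference in the
  number of parts between the two ends of a run; summed along the bijection, both numbers of parts
  are resolved into the statistics for all residues.\<close>

lemma sum_glaisher_count:
  assumes r: "r \<ge> 2" and A0: "0 \<notin> A" and A: "\<And>k. r * k \<in> A \<longleftrightarrow> k \<in> A"
  shows "(r - 1) * (\<Sum>\<rho>\<in>parts_from {k \<in> A. \<not> r dvd k} n. glaisher_count r \<rho>)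
       + (\<Sum>j\<in>{1..<r}. \<Sum>\<mu> | \<mu> \<in> parts_from A n \<and> (\<forall>k. count \<mu> k < r). y_stat j \<mu>)
       = (\<Sum>j\<in>{1..<r}. \<Sum>\<rho>\<in>parts_from {k \<in> A. \<not> r dvd k} n. x_stat r j \<rho>)"
proof -
  let ?C = "parts_from {k \<in> A. \<not> r dvd k} n"
  let ?R = "{\<mu> \<in> parts_from A n. \<forall>k. count \<mu> k < r}"
  note reindex = sum.reindex_bij_betw[OF bij_flatten[OF r A0 A, of n]]
  have z: "0 \<notin># \<mu>" if "\<mu> \<in> ?R" for \<mu>
    using that A0 by (auto simp: parts_from_def)
  have RP: "\<mu> \<in> RP r" if "\<mu> \<in> ?R" for \<mu>
    using that z[OF that] by (auto simp: RP_def partitions_def Suc_le_eq intro!: gr0I)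
  have "(\<Sum>j\<in>{1..<r}. \<Sum>\<rho>\<in>?C. x_stat r j \<rho>) = (\<Sum>\<rho>\<in>?C. \<Sum>j\<in>{1..<r}. x_stat r j \<rho>)"
    by (rule sum.swap)
  also have "\<dots> = (\<Sum>\<rho>\<in>?C. size \<rho>)"
    by (rule sum.cong[OF refl], rule size_eq_sum_x_stat[OF r, symmetric]) (auto simp: parts_from_def)
  also have "\<dots> = (\<Sum>\<mu>\<in>?R. size (flatten r \<mu>))" by (rule reindex[symmetric])
  also have "\<dots> = (\<Sum>\<mu>\<in>?R. glaisher_count r (flatten r \<mu>) * (r - 1) + size \<mu>)"
    by (rule sum.cong[OF refl], rule glaisher_count_flatten[OF r RP, symmetric]) auto
  also have "\<dots> = (r - 1) * (\<Sum>\<mu>\<in>?R. glaisher_count r (flatten r \<mu>)) + (\<Sum>\<mu>\<in>?R. size \<mu>)"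
    by (simp add: sum.distrib sum_distrib_left mult.commute)
  also have "(\<Sum>\<mu>\<in>?R. glaisher_count r (flatten r \<mu>)) = (\<Sum>\<rho>\<in>?C. glaisher_count r \<rho>)"
    by (rule reindex)
  also have "(\<Sum>\<mu>\<in>?R. size \<mu>) = (\<Sum>\<mu>\<in>?R. \<Sum>j\<in>{1..<r}. y_stat j \<mu>)"
    by (rule sum.cong[OF refl], rule size_eq_sum_y_stat) (use z in auto)
  also have "\<dots> = (\<Sum>j\<in>{1..<r}. \<Sum>\<mu>\<in>?R. y_stat j \<mu>)" by (rule sum.swap)
  finally show ?thesis by simp
qed

lemma CP_tuple_eq: "CP_tuple qs = {\<rho>. set_mset \<rho> \<subseteq> avoiding qs}"
proof (intro equalityI subsetI)
  fix \<rho> assume p: "\<rho> \<in> CP_tuple qs"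
  have "k \<in> avoiding qs" if k: "k \<in># \<rho>" for k
  proof -
    have "k \<ge> 1" using p k by (auto simp: CP_tuple_def partitions_def)
    moreover have "\<not> q dvd k" if q: "q \<in> set qs" for q
    proof
      assume "q dvd k"
      then obtain m where m: "k = q * m" by blast
      then have "m \<ge> 1" using \<open>k \<ge> 1\<close> by (cases m) auto
      obtain i where i: "i < length qs" "qs ! i = q" using q by (auto simp: in_set_conv_nth)
      have "\<forall>i<length qs. \<forall>k\<ge>1. count \<rho> (qs ! i * k) = 0" using p by (simp add: CP_tuple_def)
      from this[rule_format, OF i(1) \<open>m \<ge> 1\<close>] have "count \<rho> k = 0" by (simp add: m i(2))
      then show False using k by (simp add: count_eq_zero_iff)
    qed
    ultimately show ?thesis by (simp add: avoiding_def)
  qed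
  then show "\<rho> \<in> {\<rho>. set_mset \<rho> \<subseteq> avoiding qs}" by blast
next
  fix \<rho> assume "\<rho> \<in> {\<rho>. set_mset \<rho> \<subseteq> avoiding qs}"
  then have p: "k \<in> avoiding qs" if "k \<in># \<rho>" for k using that by blast
  have "count \<rho> (qs ! i * k) = 0" if i: "i < length qs" for i k
  proof -
    have "qs ! i * k \<notin> avoiding qs"
      using nth_mem[OF i] dvd_triv_left[of "qs ! i" k] unfolding avoiding_def by blast
    then show ?thesis using p by (auto simp: count_eq_zero_iff)
  qed
  moreover have "k \<ge> 1" if "k \<in># \<rho>" for k using p[OF that] by (simp add: avoiding_def)
  ultimately show "\<rho> \<in> CP_tuple qs" by (simp add: CP_tuple_def partitions_def)
qed

theorem theorem3p5:
  fixes rs :: "nat list" and j n :: nat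
  assumes "length rs \<ge> 1"
    and "\<And>i. i < length rs \<Longrightarrow> rs ! i > 1"
    and "\<And>i k. i < length rs \<Longrightarrow> k < length rs \<Longrightarrow> i \<noteq> k \<Longrightarrow> coprime (rs ! i) (rs ! k)"
    and "\<And>i. 1 \<le> i \<Longrightarrow> i < length rs \<Longrightarrow> [rs ! i = 1] (mod rs ! 0)"
    and "1 \<le> j" and "j \<le> rs ! 0 - 1"
    and "n > 0"
  shows "int (X_sum rs j n) - int (Y_sum rs j n) = int (c_sum rs n)"
proof -
  obtain r ss where rs: "rs = r # ss" using assms(1) by (cases rs) auto
  have r: "r \<ge> 2" using assms(2)[of 0] rs by simp
  have gt: "s > 1" and one: "[s = 1] (mod r)" and cop: "coprime s r" if "s \<in> set ss" for s
  proof -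
    from that obtain i where i: "i < length ss" "s = ss ! i" by (metis in_set_conv_nth)
    show "s > 1" "[s = 1] (mod r)" "coprime s r"
      using assms(2)[of "Suc i"] assms(4)[of "Suc i"] assms(3)[of "Suc i" 0] i rs by auto
  qed
  have copss: "sorted_wrt coprime ss"
    unfolding sorted_wrt_iff_nth_less
    using assms(3)[of "Suc _" "Suc _"] rs by auto
  define A where "A = avoiding ss"
  define C where "C = parts_from {k \<in> A. \<not> r dvd k} n"
  define R where "R = {\<mu>. \<mu> \<in> parts_from A n \<and> (\<forall>k. count \<mu> k < r)}"
  have A0: "0 \<notin> A" by (simp add: A_def avoiding_def)
  have A: "r * k \<in> A \<longleftrightarrow> k \<in> A" for k
    using r cop by (auto simp: A_def avoiding_def coprime_dvd_mult_right_iff)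
  have C: "of_size (CP_tuple rs) n = C"
  proof -
    have "avoiding rs = {k \<in> A. \<not> r dvd k}" by (auto simp: rs A_def avoiding_def)
    then show ?thesis by (simp add: CP_tuple_eq of_size_def C_def parts_from_def)
  qed
  have "RP r \<inter> {\<rho>. set_mset \<rho> \<subseteq> A} = {\<rho>. set_mset \<rho> \<subseteq> A \<and> (\<forall>k. count \<rho> k < r)}"
  proof (intro equalityI subsetI)
    fix \<rho> assume p: "\<rho> \<in> RP r \<inter> {\<rho>. set_mset \<rho> \<subseteq> A}"
    have "count \<rho> k < r" for k
    proof (cases "k = 0")
      case True
      then have "k \<notin># \<rho>" using p A0 by auto
      then show ?thesis using r by (simp add: not_in_iff)
    qed (use p in \<open>auto simp: RP_def\<close>)
    then show "\<rho> \<in> {\<rho>. set_mset \<rho> \<subseteq> A \<and> (\<forall>k. count \<rho> k < r)}" using p by auto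
  qed (use A0 in \<open>auto simp: RP_def partitions_def Suc_le_eq intro!: gr0I\<close>)
  then have R: "of_size (RP_tuple rs) n = R"
    unfolding of_size_def RP_tuple_def R_def parts_from_def rs CP_tuple_eq list.sel A_def[symmetric]
    by blast
  define U where "U J = (\<Sum>(k, l) \<in> {(k, l). k \<in> A \<inter> {1..n} \<and> l \<in> {1..n} \<and> [l = J] (mod r)}.
      core_count A r n (k * l))" for J
  have X: "(\<Sum>\<rho>\<in>C. x_stat r i \<rho>) = U i" if "i \<in> {1..<r}" for i
  proof -
    have big: "core_count A r n N = 0" if "N > n" for N using that by (simp add: core_count_def)
    have "(\<Sum>\<rho>\<in>C. x_stat r i \<rho>)
        = (\<Sum>N\<in>{1..n}. core_count A r n N * divisor_count A (\<lambda>d e. [d = i] (mod r)) N)"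
      using sum_x_stat[OF A0, of i r n] that
        sum_products_by_divisor_count[where A = A and n = n and g = "core_count A r n"
            and H = "\<lambda>d e. [d = i] (mod r)", OF A0 big]
      by (simp add: C_def)
    also have "\<dots> = (\<Sum>N\<in>{1..n}. core_count A r n N * divisor_count A (\<lambda>d e. [e = i] (mod r)) N)"
      unfolding A_def using gt one copss
      by (intro sum.cong refl arg_cong2[where f = "(*)"] divisor_count_swap) fastforce+
    also have "\<dots> = U i"
      unfolding U_def
      using sum_products_by_divisor_count[where A = A and n = n and g = "core_count A r n"
          and H = "\<lambda>d e. [e = i] (mod r)", OF A0 big] by simp
    finally show ?thesis .
  qed
  have Y: "(\<Sum>\<mu>\<in>R. y_stat i \<mu>) + U r = (\<Sum>\<rho>\<in>C. x_stat r i \<rho>)" if "i \<in> {1..<r}" for i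
    using sum_y_stat[OF r A0 A, of i n] X[OF that] that by (simp add: R_def U_def)
  have "(r - 1) * (\<Sum>\<rho>\<in>C. glaisher_count r \<rho>) + (\<Sum>i\<in>{1..<r}. \<Sum>\<mu>\<in>R. y_stat i \<mu>)
      = (\<Sum>i\<in>{1..<r}. \<Sum>\<rho>\<in>C. x_stat r i \<rho>)"
    unfolding C_def R_def by (rule sum_glaisher_count[OF r A0 A])
  also have "\<dots> = (\<Sum>i\<in>{1..<r}. (\<Sum>\<mu>\<in>R. y_stat i \<mu>) + U r)"
    by (rule sum.cong) (auto simp: Y)
  also have "\<dots> = (r - 1) * U r + (\<Sum>i\<in>{1..<r}. \<Sum>\<mu>\<in>R. y_stat i \<mu>)"
    by (simp add: sum.distrib)
  finally have "(\<Sum>\<rho>\<in>C. glaisher_count r \<rho>) = U r" using r by simp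
  moreover have "j \<in> {1..<r}" using assms(5,6) r rs by auto
  ultimately show ?thesis
    using Y[of j] C R rs
    by (simp add: X_sum_def Y_sum_def c_sum_def del: of_nat_sum)
qed

end
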